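(* Let $X$ be the strongly regular graph given by an orthogonal array $\mathrm{OA}(k,n)$, and let $u$ and $v$ be two distinct vertices of $X$. If $u$ and $v$ are not adjacent, then there exist $\beta\in\mathbb{Q}$ and $\gamma=-\beta$ such that $X^{\beta,\gamma}_{u,v}$ admits perfect state transfer from $u$ to $v$ if and only if $|n|_2\geq|k|_2+2$. If $u$ and $v$ are adjacent, then there exist $\beta\in\mathbb{Q}$ and $\gamma=-\beta$ such that $X^{\beta,\gamma}_{u,v}$ admits perfect state transfer from $u$ to $v$ if and only if $|n|_2\geq|k-1|_2+2$.
   Context: For a nonzero integer $m$, $|m|_2$ denotes the largest exponent $r$ such that $2^r$ divides $m$. An orthogonal array $\mathrm{OA}(k,n)$ is a $k\times n^2$ array with entries from $\{1,\dots,n\}$ such that for any two rows of the array, the $n^2$ ordered pairs of entries (one for each column) are all distinct. The graph given by $\mathrm{OA}(k,n)$ has as vertices the $n^2$ columns of the array, two distinct columns being adjacent if they agree in exactly one coordinate position. It is taken to be a (connected) strongly regular graph, i.e. $2\le k\le n$; its eigenvalues are $(n-1)k$, $n-k$ and $-k$. For a graph $X$ with adjacency matrix $A$, distinct vertices $u,v$ and real $\beta,\gamma$, $X^{\beta,\gamma}_{u,v}$ is the weighted graph with adjacency matrix $A+H$, where $H=\beta(e_ue_v^T+e_ve_u^T)+\gamma(e_ue_u^T+e_ve_v^T)$ and $e_w$ denotes the standard basis vector indexed by $w$. For a (weighted) graph with real symmetric adjacency matrix $M$, let $U(t)=\exp(itM)$. There is perfect state transfer from $u$ to $v$ if $|U(t)_{u,v}|=1$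 for some $t>0$.
   Formalization: The non-adjacent part is stated only for k < n: when k = n, non-adjacent u, v are twins in a complete multipartite graph, and β = n/4, γ = −β gives perfect state transfer at t = 2π/n although |n|_2 ≥ |k|_2+2 fails. *)

theory Defs
  imports
    Complex_Main
    "HOL-Computational_Algebra.Primes"
    "Jordan_Normal_Form.Matrix"
begin

text \<open>Rows and columns are numbered from 0, as in \<open>'a mat\<close>; the entries range over \<open>{1..n}\<close>.\<close>

definition orthogonal_array :: "nat \<Rightarrow> nat \<Rightarrow> nat mat \<Rightarrow> bool" where
  "orthogonal_array k n R \<longleftrightarrow>
     R \<in> carrier_mat k (n\<^sup>2) \<and>
     (\<forall>i<k. \<forall>c<n\<^sup>2. R $$ (i, c) \<in> {1..n}) \<and>
     (\<forall>i<k. \<forall>j<k. i \<noteq> j \<longrightarrow> inj_on (\<lambda>c. (R $$ (i, c), R $$ (j, c))) {..<n\<^sup>2})"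

text \<open>The vertices of the graph of an array are its column indices \<open>{..<dim_col R}\<close>.
  An \<open>OA(n, n)\<close> gives the complete multipartite graph with \<open>n\<close> parts of size \<open>n\<close>. There two
  nonadjacent vertices \<open>u\<close>, \<open>v\<close> have the same neighbours, so $e_u - e_v$ is an eigenvector of every
  perturbed matrix with $\gamma = -\beta$; perfect state transfer from \<open>u\<close> to \<open>v\<close> is then always
  achieved by some rational $\beta$ (for instance $\beta = n/4$ for \<open>n > 2\<close> and $\beta = 0$ for
  \<open>n = 2\<close>), whatever the power of 2 dividing \<open>n\<close>.\<close>

definition oa_adjacent :: "nat mat \<Rightarrow> nat \<Rightarrow> nat \<Rightarrow> bool" where
  "oa_adjacent R c d \<longleftrightarrow> c \<noteq> d \<and> card {i. i < dim_row R \<and> R $$ (i, c) = R $$ (i, d)} = 1"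

definition adjacency_mat :: "nat \<Rightarrow> (nat \<Rightarrow> nat \<Rightarrow> bool) \<Rightarrow> real mat" where
  "adjacency_mat N adj = mat N N (\<lambda>(i, j). if adj i j then 1 else 0)"

definition oa_graph_mat :: "nat mat \<Rightarrow> real mat" where
  "oa_graph_mat R = adjacency_mat (dim_col R) (oa_adjacent R)"

text \<open>The matrix unit $e_u e_v^T$.\<close>

definition mat_unit :: "nat \<Rightarrow> nat \<Rightarrow> nat \<Rightarrow> real mat" where
  "mat_unit N u v = mat N N (\<lambda>(i, j). if i = u \<and> j = v then 1 else 0)"

definition perturbed_mat :: "real mat \<Rightarrow> nat \<Rightarrow> nat \<Rightarrow> real \<Rightarrow> real \<Rightarrow> real mat" where
  "perturbed_mat A u v \<beta> \<gamma> =
     (let N = dim_row A in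
      A + (\<beta> \<cdot>\<^sub>m (mat_unit N u v + mat_unit N v u) + \<gamma> \<cdot>\<^sub>m (mat_unit N u u + mat_unit N v v)))"

text \<open>The exponential series, summed entrywise; for a square matrix every entry converges
  absolutely.\<close>

definition mat_exp :: "complex mat \<Rightarrow> complex mat" where
  "mat_exp A = mat (dim_row A) (dim_row A) (\<lambda>(i, j). \<Sum>m. (A ^\<^sub>m m) $$ (i, j) / fact m)"

definition transition_mat :: "real mat \<Rightarrow> real \<Rightarrow> complex mat" where
  "transition_mat M t = mat_exp ((\<i> * complex_of_real t) \<cdot>\<^sub>m map_mat complex_of_real M)"

definition perfect_state_transfer :: "real mat \<Rightarrow> nat \<Rightarrow> nat \<Rightarrow> bool" where
  "perfect_state_transfer M u v \<longleftrightarrow> (\<exists>t>0. cmod (transition_mat M t $$ (u, v)) = 1)"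

end

theory Submission
  imports Defs
begin

text \<open>
  Let \<open>B = A + k I\<close>, whose \<open>(c, d)\<close> entry counts the rows in which columns \<open>c\<close> and \<open>d\<close> agree,
  and let \<open>j\<close> be the number of rows in which \<open>u\<close> and \<open>v\<close> differ: \<open>j = k\<close> for nonadjacent and
  \<open>j = k - 1\<close> for adjacent vertices. Any two rows of the array run through all pairs of symbols,
  so \<open>B\<^sup>2 = n B + k (k - 1) J\<close> with \<open>J\<close> the all-ones matrix (\<open>sum_agreements_mult\<close>), and \<open>B\<close> has
  the eigenvalues \<open>k n\<close>, \<open>n\<close> and \<open>0\<close>. Passing from \<open>A\<close> to \<open>B\<close> multiplies \<open>U(t)\<close> by a global
  phase only.

  For \<open>\<gamma> = -\<beta>\<close> the perturbation is \<open>-\<beta> w w\<^sup>T\<close> with \<open>w = e\<^sub>u - e\<^sub>v\<close>. It annihilates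
  \<open>e\<^sub>u + e\<^sub>v\<close> and all of the space generated from it by \<open>B\<close>, where the eigenvalues remain \<open>k n\<close>,
  \<open>n\<close> and \<open>0\<close>. Since \<open>J w = 0\<close>, the vectors \<open>w\<close> and \<open>B w\<close> span an invariant plane. On it the
  perturbed matrix has eigenvalues \<open>x\<close> and \<open>x'\<close> with \<open>x + x' = n - 2 \<beta>\<close> and
  \<open>x x' = - 2 \<beta> (n - j)\<close>. Writing \<open>e\<^sub>v = (e\<^sub>u + e\<^sub>v) / 2 - w / 2\<close> exhibits \<open>U(t)\<^sub>u\<^sub>v\<close>, up to the
  global phase, as a convex combination of the unit numbers \<open>cis (t \<mu>)\<close>, for \<open>\<mu>\<close> among \<open>k n\<close>,
  \<open>n\<close>, \<open>0\<close>, and \<open>- cis (t y)\<close>, for \<open>y\<close> among \<open>x\<close>, \<open>x'\<close> (\<open>transition_mat_modes\<close>). Its modulus is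
  1 only if all terms of positive weight coincide. Hence transfer occurs at time \<open>t\<close> exactly
  if \<open>t = 2 \<pi> m / n\<close> for a positive integer \<open>m\<close> and \<open>x = c n / (2 m)\<close>, \<open>x' = c' n / (2 m)\<close> with \<open>c\<close>, \<open>c'\<close>
  odd (\<open>transfer_time_iff\<close>).

  Eliminating \<open>\<beta>\<close> from the sum and the product of \<open>x\<close> and \<open>x'\<close> leaves the Diophantine equation
  \<open>n c c' = 2 m (n - j) (c + c' - 2 m)\<close>, and a solution of it gives back a rational \<open>\<beta>\<close>. As
  \<open>c + c'\<close> is even, 4 times the power of 2 in \<open>n - j\<close> divides \<open>n\<close>. Then \<open>n - j\<close> and \<open>j\<close> contain
  the same power of 2, which gives the stated bound; conversely, under the bound an
  explicit solution can be written down (\<open>transfer_equation_solvable_iff\<close>).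
\<close>

section \<open>Phases and their convex combinations\<close>

lemma sum_of_bool_delta:
  fixes f :: "'a \<Rightarrow> 'b::semiring_1"
  assumes "finite A" "a \<in> A"
  shows "(\<Sum>c\<in>A. of_bool (a = c) * f c) = f a"
    and "(\<Sum>c\<in>A. of_bool (c = a) * f c) = f a"
    and "(\<Sum>c\<in>A. f c * of_bool (c = a)) = f a"
proof -
  have delta: "(\<Sum>c\<in>A. if c = a then f c else 0) = f a" using assms by simp
  show "(\<Sum>c\<in>A. of_bool (a = c) * f c) = f a" "(\<Sum>c\<in>A. of_bool (c = a) * f c) = f a"
    "(\<Sum>c\<in>A. f c * of_bool (c = a)) = f a"
    unfolding delta [symmetric] by (intro sum.cong; simp)+
qed

text \<open>With \<open>S\<close> the combination, the real parts of the \<open>z\<^sub>l cnj S\<close> are at most 1 and have weighted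
  mean \<open>|S|\<^sup>2 = 1\<close>, so each one of positive weight equals 1; that forces \<open>z\<^sub>l = S\<close>.\<close>

lemma convex_comb_unit_norm:
  fixes z :: "'a \<Rightarrow> complex" and c :: "'a \<Rightarrow> real"
  assumes "finite L" and c: "\<And>l. l \<in> L \<Longrightarrow> 0 \<le> c l" and "sum c L = 1"
    and z: "\<And>l. l \<in> L \<Longrightarrow> cmod (z l) = 1"
    and S: "cmod (\<Sum>l\<in>L. c l * z l) = 1"
    and l: "l \<in> L" "0 < c l"
  shows "z l = (\<Sum>l\<in>L. c l * z l)"
proof -
  define S where "S = (\<Sum>l\<in>L. c l * z l)"
  have SS: "S * cnj S = 1"
    using S unfolding S_def [symmetric] by (metis complex_norm_square of_real_1 power_one)
  have le: "Re (z l * cnj S) \<le> 1" if "l \<in> L" for l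
    using complex_Re_le_cmod [of "z l * cnj S"] z [OF that] S
    by (simp add: norm_mult S_def [symmetric])
  have "(\<Sum>l\<in>L. c l * Re (z l * cnj S)) = Re (S * cnj S)"
    unfolding S_def sum_distrib_right Re_sum by (intro sum.cong) (simp_all add: algebra_simps)
  then have "(\<Sum>l\<in>L. c l * (1 - Re (z l * cnj S))) = 0"
    using SS \<open>sum c L = 1\<close> by (simp add: right_diff_distrib sum_subtractf)
  then have "c l * (1 - Re (z l * cnj S)) = 0"
    using sum_nonneg_eq_0_iff [OF \<open>finite L\<close>, of "\<lambda>l. c l * (1 - Re (z l * cnj S))"] c le l
    by auto
  then have re: "Re (z l * cnj S) = 1" using l by simp
  have "cmod (z l * cnj S) = 1"
    using z [OF l(1)] S by (simp add: norm_mult S_def [symmetric])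
  then have "(Re (z l * cnj S))\<^sup>2 + (Im (z l * cnj S))\<^sup>2 = 1"
    by (metis cmod_power2 power_one)
  then have "Im (z l * cnj S) = 0" unfolding re by simp
  then have "z l * cnj S = 1" using re by (simp add: complex_eq_iff)
  then have "z l * (S * cnj S) = S" by (metis mult.assoc mult.commute mult_1)
  then have "z l = S" unfolding SS by simp
  then show ?thesis by (simp only: S_def)
qed

lemma cis_eq_minus_1_iff: "cis x = -1 \<longleftrightarrow> (\<exists>c::int. odd c \<and> x = c * pi)"
proof
  assume "cis x = -1"
  then have "cos (x - pi) = 1" by (simp add: complex_eq_iff)
  then obtain i :: int where "x - pi = real_of_int i * 2 * pi" unfolding cos_one_2pi_int by blast
  then have "x = real_of_int (2 * i + 1) * pi" by (simp add: algebra_simps)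
  then show "\<exists>c::int. odd c \<and> x = c * pi"
    by (intro exI [of _ "2 * i + 1"]) simp
next
  assume "\<exists>c::int. odd c \<and> x = c * pi"
  then obtain i :: int where "x = (2 * i + 1) * pi" by (auto elim!: oddE)
  then have "cis x = cis (2 * pi * i) * cis pi" by (simp add: cis_mult algebra_simps del: cis_pi)
  then show "cis x = -1" by (simp add: cis_multiple_2pi del: cis_pi) simp
qed

section \<open>Entries of the transition matrix from eigenvectors\<close>

lemma pow_mat_eigenvector:
  fixes M :: "'a::comm_ring_1 mat"
  assumes M: "M \<in> carrier_mat N N"
    and ev: "\<And>i. i < N \<Longrightarrow> (\<Sum>j<N. M $$ (i, j) * f j) = x * f i"
    and "i < N"
  shows "(\<Sum>j<N. (M ^\<^sub>m m) $$ (i, j) * f j) = x ^ m * f i"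
proof (induction m)
  case 0
  then show ?case using \<open>i < N\<close> M by (simp add: if_distrib if_distribR sum.delta' cong: if_cong)
next
  case (Suc m)
  have P: "M ^\<^sub>m m \<in> carrier_mat N N" using M by simp
  have "(\<Sum>j<N. (M ^\<^sub>m Suc m) $$ (i, j) * f j)
      = (\<Sum>j<N. (\<Sum>r<N. (M ^\<^sub>m m) $$ (i, r) * M $$ (r, j)) * f j)"
    using M P \<open>i < N\<close>
    by (intro sum.cong) (auto simp: scalar_prod_def lessThan_atLeast0)
  also have "\<dots> = (\<Sum>r<N. (M ^\<^sub>m m) $$ (i, r) * (\<Sum>j<N. M $$ (r, j) * f j))"
    unfolding sum_distrib_right sum_distrib_left
    by (subst sum.swap) (simp add: mult.assoc)
  also have "\<dots> = (\<Sum>r<N. (M ^\<^sub>m m) $$ (i, r) * (x * f r))"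
    by (intro sum.cong refl) (simp add: ev)
  also have "\<dots> = x * (\<Sum>r<N. (M ^\<^sub>m m) $$ (i, r) * f r)"
    by (simp add: sum_distrib_left mult_ac)
  finally show ?case using Suc.IH by (simp add: mult_ac)
qed

text \<open>Decomposing \<open>e\<^sub>v\<close> into eigenvectors turns the series for a single entry of the exponential
  into finitely many scalar exponential series, so no convergence theory for matrices enters.\<close>

lemma transition_mat_entry:
  fixes M :: "real mat" and f :: "'l \<Rightarrow> nat \<Rightarrow> real" and x :: "'l \<Rightarrow> real"
  assumes M: "M \<in> carrier_mat N N" and uv: "u < N" "v < N" and "finite L"
    and ev: "\<And>l i. l \<in> L \<Longrightarrow> i < N \<Longrightarrow> (\<Sum>j<N. M $$ (i, j) * f l j) = x l * f l i"
    and unit: "\<And>i. i < N \<Longrightarrow> (\<Sum>l\<in>L. f l i) = of_bool (i = v)"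
  shows "transition_mat M t $$ (u, v) = (\<Sum>l\<in>L. f l u * cis (t * x l))"
proof -
  define C where "C = (\<i> * complex_of_real t) \<cdot>\<^sub>m map_mat complex_of_real M"
  have C: "C \<in> carrier_mat N N" using M by (simp add: C_def)
  have evC: "(\<Sum>j<N. C $$ (i, j) * complex_of_real (f l j)) = (\<i> * t * x l) * f l i"
    if "l \<in> L" "i < N" for l i
  proof -
    have "(\<Sum>j<N. C $$ (i, j) * complex_of_real (f l j))
        = \<i> * t * complex_of_real (\<Sum>j<N. M $$ (i, j) * f l j)"
      using M that unfolding of_real_sum sum_distrib_left
      by (intro sum.cong) (auto simp: C_def)
    then show ?thesis using ev [OF that] by simp
  qed
  have pow: "(C ^\<^sub>m m) $$ (u, v) = (\<Sum>l\<in>L. (\<i> * t * x l) ^ m * f l u)" for m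
  proof -
    have "(C ^\<^sub>m m) $$ (u, v) = (\<Sum>j<N. (C ^\<^sub>m m) $$ (u, j) * complex_of_real (\<Sum>l\<in>L. f l j))"
      using uv by (simp add: unit if_distrib of_bool_def sum.delta cong: if_cong)
    also have "\<dots> = (\<Sum>l\<in>L. \<Sum>j<N. (C ^\<^sub>m m) $$ (u, j) * complex_of_real (f l j))"
      unfolding of_real_sum sum_distrib_left by (rule sum.swap)
    also have "\<dots> = (\<Sum>l\<in>L. (\<i> * t * x l) ^ m * f l u)"
      by (intro sum.cong refl pow_mat_eigenvector [OF C]) (use evC uv in auto)
    finally show ?thesis .
  qed
  have "(\<lambda>m. (C ^\<^sub>m m) $$ (u, v) / fact m) sums (\<Sum>l\<in>L. exp (\<i> * t * x l) * f l u)"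
    unfolding pow sum_divide_distrib
  proof (rule sums_sum)
    fix l
    show "(\<lambda>m. (\<i> * t * x l) ^ m * f l u / fact m) sums (exp (\<i> * t * x l) * f l u)"
      using sums_mult2 [OF exp_converges [of "\<i> * t * x l"], of "f l u"]
      by (simp add: scaleR_conv_of_real field_simps)
  qed
  then show ?thesis
    using C uv
    by (simp add: transition_mat_def mat_exp_def C_def [symmetric] sums_iff cis_conv_exp mult_ac)
qed

section \<open>Agreement counts in an orthogonal array\<close>

definition agreements :: "nat mat \<Rightarrow> nat \<Rightarrow> nat \<Rightarrow> nat" where
  "agreements R c d = card {i. i < dim_row R \<and> R $$ (i, c) = R $$ (i, d)}"

lemma agreements_eq_sum:
  "real (agreements R c d) = (\<Sum>i<dim_row R. of_bool (R $$ (i, c) = R $$ (i, d)))"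
proof -
  have "{i. i < dim_row R \<and> R $$ (i, c) = R $$ (i, d)}
      = {..<dim_row R} \<inter> {i. R $$ (i, c) = R $$ (i, d)}" by auto
  then show ?thesis by (simp add: agreements_def)
qed

lemma oa_adjacent_iff: "oa_adjacent R c d \<longleftrightarrow> c \<noteq> d \<and> agreements R c d = 1"
  by (simp add: oa_adjacent_def agreements_def)

lemma agreements_commute: "agreements R c d = agreements R d c"
  unfolding agreements_def by metis

locale oa =
  fixes k n :: nat and R :: "nat mat"
  assumes two_le_k: "2 \<le> k" and k_le_n: "k \<le> n" and array: "orthogonal_array k n R"
begin

lemma dims [simp]: "dim_row R = k" "dim_col R = n\<^sup>2"
  using array by (auto simp: orthogonal_array_def)

lemma entry: "i < k \<Longrightarrow> c < n\<^sup>2 \<Longrightarrow> R $$ (i, c) \<in> {1..n}"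
  using array by (simp add: orthogonal_array_def)

lemma inj_rows: "i < k \<Longrightarrow> j < k \<Longrightarrow> i \<noteq> j \<Longrightarrow>
    inj_on (\<lambda>c. (R $$ (i, c), R $$ (j, c))) {..<n\<^sup>2}"
  using array by (simp add: orthogonal_array_def)

lemma agreements_self: "agreements R c c = k"
  by (simp add: agreements_def)

lemma agreements_le_1:
  assumes "c < n\<^sup>2" "d < n\<^sup>2" "c \<noteq> d"
  shows "agreements R c d \<le> 1"
proof -
  have "i = j" if "i < k" "j < k" "R $$ (i, c) = R $$ (i, d)" "R $$ (j, c) = R $$ (j, d)" for i j
    using inj_rows [of i j] that assms by (auto simp: inj_on_def)
  then show ?thesis
    unfolding agreements_def by (subst card_le_Suc0_iff_eq [simplified One_nat_def [symmetric]]) auto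
qed

text \<open>The matrix of agreement counts is the adjacency matrix shifted by \<open>k I\<close>; it is a sum of one
  block matrix per row of the array, which makes its square computable.\<close>

lemma oa_graph_mat_entry:
  assumes "c < n\<^sup>2" "d < n\<^sup>2"
  shows "oa_graph_mat R $$ (c, d) = real (agreements R c d) - real k * of_bool (c = d)"
  using assms agreements_le_1 [of c d] agreements_self [of c]
  by (auto simp: oa_graph_mat_def adjacency_mat_def oa_adjacent_iff le_Suc_eq)

lemma rows_bij:
  assumes "i < k" "j < k" "i \<noteq> j"
  shows "bij_betw (\<lambda>c. (R $$ (i, c), R $$ (j, c))) {..<n\<^sup>2} ({1..n} \<times> {1..n})"
  unfolding bij_betw_def
proof (intro conjI inj_rows assms card_subset_eq)
  show "(\<lambda>c. (R $$ (i, c), R $$ (j, c))) ` {..<n\<^sup>2} \<subseteq> {1..n} \<times> {1..n}"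
    using entry assms by fast
  show "card ((\<lambda>c. (R $$ (i, c), R $$ (j, c))) ` {..<n\<^sup>2}) = card ({1..n} \<times> {1..n})"
    using card_image [OF inj_rows [OF assms]] by (simp add: card_cartesian_product power2_eq_square)
qed auto

text \<open>All counting in the array reduces to this: a pair of distinct rows lists each pair of symbols
  exactly once.\<close>

lemma sum_two_rows:
  assumes "i < k" "j < k" "i \<noteq> j"
  shows "(\<Sum>c<n\<^sup>2. g (R $$ (i, c)) (R $$ (j, c))) = (\<Sum>x\<in>{1..n}. \<Sum>y\<in>{1..n}. g x y)"
proof -
  have "(\<Sum>c<n\<^sup>2. g (R $$ (i, c)) (R $$ (j, c))) = (\<Sum>(x, y)\<in>{1..n} \<times> {1..n}. g x y)"
    using sum.reindex_bij_betw [OF rows_bij [OF assms], of "\<lambda>(x, y). g x y"] by simp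
  then show ?thesis by (simp add: sum.cartesian_product)
qed

lemma sum_row_eq:
  assumes "i < k" "x \<in> {1..n}"
  shows "(\<Sum>c<n\<^sup>2. of_bool (x = R $$ (i, c))) = real n"
proof -
  obtain j where j: "j < k" "i \<noteq> j"
    by (rule that [of "if i = 0 then 1 else 0"]) (use two_le_k in auto)
  show ?thesis
    using sum_two_rows [OF assms(1) j, of "\<lambda>y _. of_bool (x = y) :: real"] assms(2)
    by (simp add: sum_distrib_left [symmetric] of_bool_def sum.delta')
qed

lemma sum_agreements:
  assumes "c < n\<^sup>2"
  shows "(\<Sum>e<n\<^sup>2. real (agreements R c e)) = k * n"
proof -
  have "(\<Sum>e<n\<^sup>2. real (agreements R c e))
      = (\<Sum>i<k. \<Sum>e<n\<^sup>2. of_bool (R $$ (i, c) = R $$ (i, e)))"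
    unfolding agreements_eq_sum dims by (rule sum.swap)
  also have "\<dots> = (\<Sum>i<k. real n)"
    by (intro sum.cong refl sum_row_eq entry assms) simp_all
  finally show ?thesis by simp
qed

text \<open>The square of the matrix of agreement counts. Split it over pairs of rows \<open>(i, j)\<close>: two distinct
  rows admit exactly one column \<open>e\<close> with prescribed symbols, while for \<open>i = j\<close> there are \<open>n\<close> such
  columns or none, according to whether \<open>c\<close> and \<open>d\<close> agree in that row.\<close>

lemma sum_agreements_mult:
  assumes "c < n\<^sup>2" "d < n\<^sup>2"
  shows "(\<Sum>e<n\<^sup>2. real (agreements R c e) * real (agreements R e d))
      = n * real (agreements R c d) + k * (real k - 1)"
proof -
  have inner: "(\<Sum>e<n\<^sup>2. of_bool (R $$ (i, c) = R $$ (i, e)) * of_bool (R $$ (j, e) = R $$ (j, d)))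
      = 1 + of_bool (i = j) * (real n * of_bool (R $$ (i, c) = R $$ (i, d)) - 1)"
    if "i < k" "j < k" for i j
  proof (cases "i = j")
    case True
    have "(\<Sum>e<n\<^sup>2. of_bool (R $$ (i, c) = R $$ (i, e)) * of_bool (R $$ (i, e) = R $$ (i, d)))
        = (\<Sum>e<n\<^sup>2. of_bool (R $$ (i, c) = R $$ (i, e)) * of_bool (R $$ (i, c) = R $$ (i, d)) :: real)"
      by (intro sum.cong) auto
    also have "\<dots> = real n * of_bool (R $$ (i, c) = R $$ (i, d))"
      unfolding sum_distrib_right [symmetric] using that assms entry by (simp only: sum_row_eq)
    finally show ?thesis using True by simp
  next
    case False
    then show ?thesis
      using sum_two_rows [OF that False,
          of "\<lambda>x y. of_bool (R $$ (i, c) = x) * of_bool (y = R $$ (j, d)) :: real"]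
        entry [OF that(1) assms(1)] entry [OF that(2) assms(2)]
      by (simp add: sum_distrib_left [symmetric] sum_distrib_right [symmetric] of_bool_def
          sum.delta sum.delta')
  qed
  have "(\<Sum>e<n\<^sup>2. real (agreements R c e) * real (agreements R e d))
      = (\<Sum>i<k. \<Sum>j<k. \<Sum>e<n\<^sup>2.
          of_bool (R $$ (i, c) = R $$ (i, e)) * of_bool (R $$ (j, e) = R $$ (j, d)))"
    unfolding agreements_eq_sum sum_product dims
    by (rule trans [OF sum.swap]) (intro sum.cong refl sum.swap)
  also have "\<dots> = (\<Sum>i<k. \<Sum>j<k. 1 + of_bool (i = j) *
      (real n * of_bool (R $$ (i, c) = R $$ (i, d)) - 1))"
    by (intro sum.cong refl inner) auto
  also have "\<dots> = (\<Sum>i<k. real k + (real n * of_bool (R $$ (i, c) = R $$ (i, d)) - 1))"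
    by (intro sum.cong refl)
      (simp add: sum.distrib sum_distrib_right [symmetric] of_bool_def sum.delta')
  also have "\<dots> = n * real (agreements R c d) + k * (real k - 1)"
    unfolding agreements_eq_sum
    by (simp add: sum.distrib sum_subtractf sum_distrib_left algebra_simps)
  finally show ?thesis .
qed

end

section \<open>Eigenvectors of the perturbed matrix\<close>

text \<open>Here \<open>j\<close> counts the rows in which \<open>u\<close> and \<open>v\<close> differ. The condition \<open>j < n\<close> excludes exactly
  the nonadjacent pairs of an array with \<open>k = n\<close>, for which \<open>e\<^sub>u - e\<^sub>v\<close> is itself an eigenvector.\<close>

locale oa_pair = oa +
  fixes u v :: nat and j :: nat
  assumes u: "u < n\<^sup>2" and v: "v < n\<^sup>2" and uv: "u \<noteq> v"
    and j_def: "j = k - agreements R u v"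
    and j_less: "j < n"
begin

abbreviation M :: "real \<Rightarrow> real mat" where
  "M \<beta> \<equiv> perturbed_mat (oa_graph_mat R) u v \<beta> (-\<beta>)"

abbreviation b :: "nat \<Rightarrow> nat \<Rightarrow> real" where
  "b c d \<equiv> real (agreements R c d)"

lemma j_pos: "0 < j"
  using agreements_le_1 [OF u v uv] two_le_k by (simp add: j_def)

lemma b_uv: "b u v = real k - j" "b v u = real k - j"
  using agreements_le_1 [OF u v uv] two_le_k
  by (simp_all add: j_def agreements_commute [of R v u])

lemma M_carrier: "M \<beta> \<in> carrier_mat (n\<^sup>2) (n\<^sup>2)"
  by (simp add: perturbed_mat_def Let_def oa_graph_mat_def adjacency_mat_def mat_unit_def)

text \<open>The perturbation with \<open>\<gamma> = - \<beta>\<close> is the rank-one matrix \<open>- \<beta> w w\<^sup>T\<close>, \<open>w = e\<^sub>u - e\<^sub>v\<close>.\<close>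

lemma M_apply:
  fixes f :: "nat \<Rightarrow> real"
  assumes "i < n\<^sup>2"
  shows "(\<Sum>c<n\<^sup>2. M \<beta> $$ (i, c) * f c)
      = (\<Sum>c<n\<^sup>2. b i c * f c) - k * f i
        - \<beta> * (of_bool (i = u) - of_bool (i = v)) * (f u - f v)"
proof -
  have entry: "M \<beta> $$ (i, c) = b i c - real k * of_bool (i = c)
      - \<beta> * (of_bool (i = u) - of_bool (i = v)) * (of_bool (c = u) - of_bool (c = v))"
    if "c < n\<^sup>2" for c
  proof -
    have "M \<beta> $$ (i, c) = oa_graph_mat R $$ (i, c)
        - \<beta> * (of_bool (i = u) - of_bool (i = v)) * (of_bool (c = u) - of_bool (c = v))"
      using assms that uv
      by (simp add: perturbed_mat_def Let_def oa_graph_mat_def adjacency_mat_def mat_unit_def)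
    then show ?thesis using oa_graph_mat_entry [OF assms that] by simp
  qed
  have "(\<Sum>c<n\<^sup>2. M \<beta> $$ (i, c) * f c)
      = (\<Sum>c<n\<^sup>2. b i c * f c - real k * (of_bool (i = c) * f c)
        - \<beta> * (of_bool (i = u) - of_bool (i = v)) * (of_bool (c = u) * f c - of_bool (c = v) * f c))"
  proof (intro sum.cong refl)
    fix c assume "c \<in> {..<n\<^sup>2}"
    then have "c < n\<^sup>2" by simp
    show "M \<beta> $$ (i, c) * f c = b i c * f c - real k * (of_bool (i = c) * f c)
        - \<beta> * (of_bool (i = u) - of_bool (i = v)) * (of_bool (c = u) * f c - of_bool (c = v) * f c)"
      unfolding entry [OF \<open>c < n\<^sup>2\<close>] by (simp only: left_diff_distrib mult.assoc)
  qed
  also have "\<dots> = (\<Sum>c<n\<^sup>2. b i c * f c) - k * (\<Sum>c<n\<^sup>2. of_bool (i = c) * f c)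
        - \<beta> * (of_bool (i = u) - of_bool (i = v))
          * ((\<Sum>c<n\<^sup>2. of_bool (c = u) * f c) - (\<Sum>c<n\<^sup>2. of_bool (c = v) * f c))"
    by (simp only: sum_subtractf sum_distrib_left [symmetric])
  finally show ?thesis
    using assms u v by (simp add: sum_of_bool_delta del: sum_of_bool_mult_eq)
qed

text \<open>The component of \<open>(e\<^sub>u + e\<^sub>v) / 2\<close> in the eigenspace of the agreement matrix for the eigenvalue
  \<open>\<mu>\<close>, where \<open>\<mu>\<close> is \<open>k n\<close>, \<open>n\<close> or, as the remaining case, \<open>0\<close>. These formulas come from applying the
  quadratic relation for the agreement matrix on the complement of the all-ones vector.\<close>

definition sym_vec :: "real \<Rightarrow> nat \<Rightarrow> real" where
  "sym_vec \<mu> i =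
    (if \<mu> = real k * n then 1 / n\<^sup>2
     else if \<mu> = real n then (b i u + b i v) / (2 * n) - k / n\<^sup>2
     else (of_bool (i = u) + of_bool (i = v)) / 2 - (b i u + b i v) / (2 * n) + (real k - 1) / n\<^sup>2)"

text \<open>The component of \<open>- (e\<^sub>u - e\<^sub>v) / 2\<close> for the eigenvalue \<open>x\<close> on the plane spanned by
  \<open>w = e\<^sub>u - e\<^sub>v\<close> and \<open>B w\<close>, with \<open>x'\<close> the other eigenvalue there: every eigenvector for \<open>x\<close> is a multiple of
  \<open>(n - x) w - B w\<close>, and the factor \<open>1 / (2 (x - x'))\<close> cancels \<open>B w\<close> in the sum of the two components.\<close>

definition skew_vec :: "real \<Rightarrow> real \<Rightarrow> nat \<Rightarrow> real" where
  "skew_vec x x' i =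
    ((real n - x) * (of_bool (i = u) - of_bool (i = v)) - (b i u - b i v)) / (2 * (x - x'))"

text \<open>The span of \<open>e\<^sub>u\<close>, \<open>e\<^sub>v\<close>, their images under the agreement matrix and the all-ones vector is
  invariant; every eigenvector used below lies in it.\<close>

lemma b_apply_pair:
  fixes p q r s z :: real
  assumes "i < n\<^sup>2"
  shows "(\<Sum>c<n\<^sup>2. b i c * (p * of_bool (c = u) + q * of_bool (c = v) + r * b c u + s * b c v + z))
    = p * b i u + q * b i v + r * (n * b i u + k * (real k - 1))
      + s * (n * b i v + k * (real k - 1)) + z * (k * n)"
proof -
  have "(\<Sum>c<n\<^sup>2. b i c * (p * of_bool (c = u) + q * of_bool (c = v) + r * b c u + s * b c v + z))
    = p * (\<Sum>c<n\<^sup>2. b i c * of_bool (c = u)) + q * (\<Sum>c<n\<^sup>2. b i c * of_bool (c = v))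
      + r * (\<Sum>c<n\<^sup>2. b i c * b c u) + s * (\<Sum>c<n\<^sup>2. b i c * b c v) + z * (\<Sum>c<n\<^sup>2. b i c)"
    unfolding sum_distrib_left sum.distrib [symmetric] by (intro sum.cong) (auto simp: algebra_simps)
  then show ?thesis
    using u v by (simp add: sum_agreements_mult [OF assms] sum_agreements [OF assms]
        sum_of_bool_delta del: sum_mult_of_bool_eq)
qed

lemma n_pos: "0 < real n" and k_n: "real k * n \<noteq> n" "real k * n \<noteq> 0" "real n \<noteq> 0"
  using two_le_k k_le_n by auto

text \<open>A vector with equal entries at \<open>u\<close> and \<open>v\<close> is orthogonal to \<open>e\<^sub>u - e\<^sub>v\<close>, so the perturbation does
  not act on it and its eigenvalue is independent of \<open>\<beta>\<close>.\<close>

lemma sym_vec_eigen: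
  assumes "i < n\<^sup>2" "\<mu> \<in> {real k * n, real n, 0}"
  shows "(\<Sum>c<n\<^sup>2. M \<beta> $$ (i, c) * sym_vec \<mu> c) = (\<mu> - k) * sym_vec \<mu> i"
proof -
  have eq: "sym_vec \<mu> u = sym_vec \<mu> v"
    using b_uv agreements_self by (simp add: sym_vec_def uv uv [symmetric])
  have "(\<Sum>c<n\<^sup>2. b i c * sym_vec \<mu> c) = \<mu> * sym_vec \<mu> i"
  proof -
    consider "\<mu> = real k * n" | "\<mu> = real n" | "\<mu> = 0" using assms by auto
    then show ?thesis
    proof cases
      case 1
      then have f: "sym_vec \<mu> = (\<lambda>c. 1 / n\<^sup>2)" by (simp add: fun_eq_iff sym_vec_def)
      show ?thesis
        unfolding f sum_distrib_right [symmetric] sum_agreements [OF assms(1)] using 1 by simp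
    next
      case 2
      then have f: "sym_vec \<mu> = (\<lambda>c. 0 * of_bool (c = u) + 0 * of_bool (c = v)
          + 1 / (2 * n) * b c u + 1 / (2 * n) * b c v + (- k / n\<^sup>2))"
        using k_n by (auto simp: sym_vec_def add_divide_distrib)
      show ?thesis
        unfolding f b_apply_pair [OF assms(1)] using k_n
        by (simp add: 2 field_simps power2_eq_square)
    next
      case 3
      then have f: "sym_vec \<mu> = (\<lambda>c. 1 / 2 * of_bool (c = u) + 1 / 2 * of_bool (c = v)
          + (- 1 / (2 * n)) * b c u + (- 1 / (2 * n)) * b c v + (real k - 1) / n\<^sup>2)"
        using k_n by (auto simp: sym_vec_def add_divide_distrib)
      show ?thesis
        unfolding f b_apply_pair [OF assms(1)] using k_n
        by (simp add: 3 field_simps power2_eq_square)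
    qed
  qed
  then show ?thesis
    unfolding M_apply [OF assms(1)] eq by (simp add: algebra_simps)
qed

text \<open>The two hypotheses on \<open>x\<close> and \<open>x'\<close> say that they are the roots of
  \<open>X\<^sup>2 - (n - 2 \<beta>) X - 2 \<beta> (n - j)\<close>, the characteristic polynomial on the plane spanned by \<open>w\<close>
  and \<open>B w\<close>.\<close>

lemma skew_vec_eigen:
  fixes x x' \<beta> :: real
  assumes "i < n\<^sup>2" and "x + x' = real n - 2 * \<beta>" "x * x' = - 2 * \<beta> * (real n - j)" and "x \<noteq> x'"
  shows "(\<Sum>c<n\<^sup>2. M \<beta> $$ (i, c) * skew_vec x x' c) = (x - k) * skew_vec x x' i"
proof -
  define h where "h = 1 / (2 * (x - x'))"
  have f: "skew_vec x x' = (\<lambda>c. h * (real n - x) * of_bool (c = u)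
      + (- h * (real n - x)) * of_bool (c = v) + (- h) * b c u + h * b c v + 0)"
  proof
    fix c
    have "skew_vec x x' c = h * ((real n - x) * (of_bool (c = u) - of_bool (c = v)) - (b c u - b c v))"
      by (simp add: skew_vec_def h_def)
    then show "skew_vec x x' c = h * (real n - x) * of_bool (c = u)
        + (- h * (real n - x)) * of_bool (c = v) + (- h) * b c u + h * b c v + 0"
      by (simp add: algebra_simps)
  qed
  have uvdiff: "skew_vec x x' u - skew_vec x x' v = 2 * h * (real n - x - j)"
    unfolding f using uv by (simp add: agreements_self b_uv algebra_simps)
  \<comment> \<open>The characteristic equation of \<open>x\<close>, in the form in which the coefficient of \<open>w\<close> needs it.\<close>
  have quad: "x * (real n - x) = - (2 * \<beta> * (real n - x - j))"
  proof -
    have "x' = real n - 2 * \<beta> - x" using assms(2) by simp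
    with assms(3) show ?thesis by (simp add: algebra_simps)
  qed
  have key: "\<beta> * W * (2 * h * (real n - x - j)) = - W * (h * (x * (real n - x)))" for W
    unfolding quad by simp
  have B: "(\<Sum>c<n\<^sup>2. b i c * skew_vec x x' c) = - h * x * (b i u - b i v)"
    unfolding f b_apply_pair [OF assms(1)] by (simp add: algebra_simps)
  have "(\<Sum>c<n\<^sup>2. M \<beta> $$ (i, c) * skew_vec x x' c)
      = - h * x * (b i u - b i v) - k * skew_vec x x' i
        + (of_bool (i = u) - of_bool (i = v)) * (h * (x * (real n - x)))"
    unfolding M_apply [OF assms(1)] uvdiff B key by simp
  also have "\<dots> = (x - k) * skew_vec x x' i"
    unfolding f by (simp add: algebra_simps)
  finally show ?thesis .
qed

lemma sym_vec_sum:
  "(\<Sum>\<mu>\<in>{real k * n, real n, 0}. sym_vec \<mu> i) = (of_bool (i = u) + of_bool (i = v)) / 2"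
proof -
  have "(\<Sum>\<mu>\<in>{real k * n, real n, 0}. sym_vec \<mu> i)
      = sym_vec (real k * n) i + sym_vec n i + sym_vec 0 i"
    using k_n two_le_k by (subst sum.insert; simp)+
  also have "\<dots> = (of_bool (i = u) + of_bool (i = v)) / 2"
    using k_n by (simp add: sym_vec_def diff_divide_distrib)
  finally show ?thesis .
qed

lemma skew_vec_sum:
  assumes "x \<noteq> x'"
  shows "skew_vec x x' i + skew_vec x' x i = - (of_bool (i = u) - of_bool (i = v)) / 2"
proof -
  have "((real n - x) * W - B) / (2 * (x - x')) + ((real n - x') * W - B) / (2 * (x' - x)) = - W / 2"
    for W B :: real
  proof -
    have "2 * (x' - x) = - (2 * (x - x'))" by simp
    then have "((real n - x) * W - B) / (2 * (x - x')) + ((real n - x') * W - B) / (2 * (x' - x))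
        = (((real n - x) * W - B) - ((real n - x') * W - B)) / (2 * (x - x'))"
      by (simp only: divide_minus_right diff_divide_distrib)
    also have "((real n - x) * W - B) - ((real n - x') * W - B) = - W * (x - x')"
      by (simp add: algebra_simps)
    also have "- W * (x - x') / (2 * (x - x')) = - W / 2"
      using assms by (intro mult_divide_mult_cancel_right) simp
    finally show ?thesis .
  qed
  then show ?thesis unfolding skew_vec_def .
qed

section \<open>The transfer amplitude as a convex combination\<close>

text \<open>The next three lemmas give the signs of the eigenvector components at \<open>u\<close>, that is, of the
  coefficients of the phases in the amplitude.\<close>

lemma sym_vec_n_pos: "0 < sym_vec (real n) u"
proof -
  have j: "j = k \<or> j + 1 = k"
    using agreements_le_1 [OF u v uv] two_le_k by (auto simp: j_def)
  have "2 * k < n * (2 * k - j)"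
    using j
  proof
    assume "j = k"
    then have "3 \<le> n" using j_less two_le_k by simp
    then have "3 * k \<le> n * k" by simp
    moreover have "2 * k - j = k" using \<open>j = k\<close> by simp
    ultimately show ?thesis using two_le_k by simp
  next
    assume "j + 1 = k"
    then have "2 * k - j = k + 1" by simp
    moreover have "2 * (k + 1) \<le> n * (k + 1)"
      using two_le_k k_le_n by (intro mult_right_mono) auto
    ultimately show ?thesis by simp
  qed
  moreover have "j \<le> 2 * k" using j by auto
  ultimately have "real (2 * k) < real n * (2 * real k - real j)"
    by (metis (no_types, lifting) of_nat_diff of_nat_less_iff of_nat_mult of_nat_numeral)
  moreover have "sym_vec (real n) u = (real n * (2 * real k - real j) - real (2 * k)) / (2 * n\<^sup>2)"
    using k_n by (simp add: sym_vec_def agreements_self b_uv field_simps power2_eq_square)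
  ultimately show ?thesis using n_pos by simp
qed

text \<open>The component for the eigenvalue 0 vanishes only for the edges of the 4-cycle, where
  \<open>k = n = 2\<close>; there \<open>e\<^sub>u + e\<^sub>v\<close> lies in the span of the other two eigenspaces.\<close>

lemma sym_vec_0_pos: "0 < sym_vec 0 u \<or> sym_vec 0 u = 0 \<and> k = 2"
proof -
  have val: "sym_vec 0 u = (real n * (real n - 2 * real k + j) + 2 * (real k - 1)) / (2 * n\<^sup>2)"
    using k_n uv by (simp add: sym_vec_def agreements_self b_uv field_simps power2_eq_square)
  have "j = k \<or> j + 1 = k"
    using agreements_le_1 [OF u v uv] two_le_k by (auto simp: j_def)
  then consider "k \<le> j + n - k" | "j + 1 = k" "k = n"
    using k_le_n j_less by fastforce
  then show ?thesis
  proof cases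
    case 1
    then have "0 \<le> real n * (real n - 2 * real k + j)"
      using two_le_k by (intro mult_nonneg_nonneg) linarith+
    then show ?thesis using val two_le_k n_pos by (simp add: zero_less_divide_iff)
  next
    case 2
    then have "real j = real k - 1" "real n = k" by linarith+
    then have "sym_vec 0 u = (real k - 2) / (2 * n\<^sup>2)"
      unfolding val \<open>real j = real k - 1\<close> \<open>real n = real k\<close> by (simp add: algebra_simps)
    then show ?thesis using two_le_k n_pos by (auto simp: zero_less_divide_iff)
  qed
qed

text \<open>Shifted by \<open>n - j\<close>, the eigenvalues \<open>x\<close> and \<open>x'\<close> have the negative product \<open>- (n - j) j\<close>: they lie on
  either side of \<open>n - j\<close>, so both components have the same sign.\<close>

lemma skew_vec_neg:
  fixes x x' \<beta> :: real
  assumes "x + x' = real n - 2 * \<beta>" "x * x' = - 2 * \<beta> * (real n - j)" "x \<noteq> x'"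
  shows "skew_vec x x' u < 0"
proof -
  define y y' where "y = x - (n - j)" and "y' = x' - (n - j)"
  have "y * y' = x * x' - (real n - j) * (x + x' - (real n - j))"
    unfolding y_def y'_def using j_less by (simp add: algebra_simps of_nat_diff)
  also have "\<dots> = - (real n - j) * j"
    unfolding assms by (simp add: algebra_simps)
  also have "\<dots> < 0"
    using j_pos j_less by (simp add: mult_less_0_iff)
  finally have "y * y' < 0" .
  moreover define r where "r = y / (y - y')"
  ultimately have "0 < r" unfolding r_def
    by (auto simp: mult_less_0_iff zero_less_divide_iff)
  moreover have "skew_vec x x' u = - r / 2"
    using uv j_less assms(3)
    by (simp add: skew_vec_def r_def y_def y'_def agreements_self b_uv of_nat_diff field_simps)
  ultimately show ?thesis by simp
qed

text \<open>The eigenvalues, tagged by whether they belong to \<open>e\<^sub>u + e\<^sub>v\<close> (left) or to \<open>e\<^sub>u - e\<^sub>v\<close> (right);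
  the tag keeps them apart when, say, \<open>x = n\<close>. A minus sign is moved from the weights to the phases
  of the right-hand modes so that all weights are nonnegative.\<close>

definition modes :: "real \<Rightarrow> real \<Rightarrow> (real + real) set" where
  "modes x x' = {real k * n, real n, 0} <+> {x, x'}"

definition weight :: "real \<Rightarrow> real \<Rightarrow> real + real \<Rightarrow> real" where
  "weight x x' = case_sum (\<lambda>\<mu>. sym_vec \<mu> u) (\<lambda>y. - skew_vec y (x + x' - y) u)"

definition phase :: "real \<Rightarrow> real + real \<Rightarrow> complex" where
  "phase t = case_sum (\<lambda>\<mu>. cis (t * \<mu>)) (\<lambda>y. - cis (t * y))"

lemma transition_mat_modes:
  fixes x x' \<beta> t :: real
  assumes x: "x + x' = real n - 2 * \<beta>" "x * x' = - 2 * \<beta> * (real n - j)" "x \<noteq> x'"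
  shows "transition_mat (M \<beta>) t $$ (u, v)
    = cis (- t * k) * (\<Sum>l\<in>modes x x'. weight x x' l * phase t l)"
proof -
  define f where "f = case_sum sym_vec (\<lambda>y. skew_vec y (x + x' - y))"
  define ev where "ev = case_sum (\<lambda>\<mu>. \<mu> - real k) (\<lambda>y. y - real k)"
  have x_swap: "x' + x = real n - 2 * \<beta>" "x' * x = - 2 * \<beta> * (real n - j)" "x' \<noteq> x"
    using x by (simp_all only: add.commute mult.commute not_sym)
  have "transition_mat (M \<beta>) t $$ (u, v) = (\<Sum>l\<in>modes x x'. f l u * cis (t * ev l))"
  proof (rule transition_mat_entry [OF M_carrier u v])
    show "finite (modes x x')" by (simp add: modes_def)
  next
    fix l i assume l: "l \<in> modes x x'" and i: "i < n\<^sup>2"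
    show "(\<Sum>c<n\<^sup>2. M \<beta> $$ (i, c) * f l c) = ev l * f l i"
    proof (cases l)
      case (Inl \<mu>)
      then show ?thesis
        using l sym_vec_eigen [OF i, of \<mu>] by (auto simp: modes_def f_def ev_def)
    next
      case (Inr y)
      then have "y = x \<or> y = x'" using l by (auto simp: modes_def)
      then show ?thesis
        using skew_vec_eigen [OF i x] skew_vec_eigen [OF i x_swap] Inr
        by (auto simp: f_def ev_def)
    qed
  next
    fix i
    have "(\<Sum>l\<in>modes x x'. f l i) = (\<Sum>\<mu>\<in>{real k * n, real n, 0}. sym_vec \<mu> i)
        + (\<Sum>y\<in>{x, x'}. skew_vec y (x + x' - y) i)"
      unfolding modes_def by (subst sum.Plus) (simp_all add: f_def del: sum.insert)
    also have "(\<Sum>y\<in>{x, x'}. skew_vec y (x + x' - y) i) = skew_vec x x' i + skew_vec x' x i"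
      using x(3) by simp
    finally show "(\<Sum>l\<in>modes x x'. f l i) = of_bool (i = v)"
      unfolding skew_vec_sum [OF x(3)] sym_vec_sum by (simp add: field_simps)
  qed
  also have "\<dots> = (\<Sum>l\<in>modes x x'. cis (- t * k) * (weight x x' l * phase t l))"
  proof (intro sum.cong refl)
    fix l
    have "cis (t * (y - k)) = cis (- t * k) * cis (t * y)" for y :: real
      by (simp add: cis_mult algebra_simps)
    then show "f l u * cis (t * ev l) = cis (- t * k) * (weight x x' l * phase t l)"
      by (cases l) (simp_all add: f_def ev_def weight_def phase_def)
  qed
  finally show ?thesis by (simp add: sum_distrib_left)
qed

lemma weights:
  fixes x x' \<beta> :: real
  assumes x: "x + x' = real n - 2 * \<beta>" "x * x' = - 2 * \<beta> * (real n - j)" "x \<noteq> x'"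
  shows weight_nonneg: "l \<in> modes x x' \<Longrightarrow> 0 \<le> weight x x' l"
    and weight_sum: "sum (weight x x') (modes x x') = 1"
    and weight_skew_pos: "0 < weight x x' (Inr x)" "0 < weight x x' (Inr x')"
proof -
  have x_swap: "x' + x = real n - 2 * \<beta>" "x' * x = - 2 * \<beta> * (real n - j)" "x' \<noteq> x"
    using x by (simp_all only: add.commute mult.commute not_sym)
  show *: "0 < weight x x' (Inr x)" "0 < weight x x' (Inr x')"
    using skew_vec_neg [OF x] skew_vec_neg [OF x_swap] by (simp_all add: weight_def)
  show "l \<in> modes x x' \<Longrightarrow> 0 \<le> weight x x' l"
    using * sym_vec_n_pos sym_vec_0_pos by (auto simp: modes_def weight_def sym_vec_def)
  have "sum (weight x x') (modes x x')
      = (\<Sum>\<mu>\<in>{real k * n, real n, 0}. sym_vec \<mu> u) + - (skew_vec x x' u + skew_vec x' x u)"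
    using x(3) unfolding modes_def
    by (subst sum.Plus) (simp_all add: weight_def sum_negf del: sum.insert, simp)
  then show "sum (weight x x') (modes x x') = 1"
    unfolding sym_vec_sum skew_vec_sum [OF x(3)] using uv by simp
qed

text \<open>All phases of positive weight coincide. The mode \<open>0\<close> has phase 1, which determines the common value;
  if it has weight 0, then \<open>k = 2\<close>, and the modes \<open>n\<close> and \<open>k n = 2 n\<close> give \<open>S\<^sup>2 = S\<close> instead.\<close>

lemma transfer_time_iff:
  fixes x x' \<beta> t :: real
  assumes x: "x + x' = real n - 2 * \<beta>" "x * x' = - 2 * \<beta> * (real n - j)" "x \<noteq> x'"
  shows "cmod (transition_mat (M \<beta>) t $$ (u, v)) = 1
    \<longleftrightarrow> cis (t * n) = 1 \<and> cis (t * x) = -1 \<and> cis (t * x') = -1"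
proof
  define S where "S = (\<Sum>l\<in>modes x x'. weight x x' l * phase t l)"
  assume "cmod (transition_mat (M \<beta>) t $$ (u, v)) = 1"
  then have S: "cmod S = 1"
    using transition_mat_modes [OF x, of t] by (simp add: norm_mult S_def)
  have eq: "phase t l = S" if "l \<in> modes x x'" "0 < weight x x' l" for l
    unfolding S_def
  proof (rule convex_comb_unit_norm [OF _ _ weight_sum [OF x] _ _ that])
    show "finite (modes x x')" by (simp add: modes_def)
    show "0 \<le> weight x x' l" if "l \<in> modes x x'" for l by (rule weight_nonneg [OF x that])
    show "cmod (phase t l) = 1" for l by (cases l) (simp_all add: phase_def)
    show "cmod (\<Sum>l\<in>modes x x'. weight x x' l * phase t l) = 1" using S by (simp only: S_def)
  qed
  have kn: "cis (t * (real k * n)) = S"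
    using eq [of "Inl (real k * n)"] n_pos by (auto simp: modes_def weight_def sym_vec_def phase_def)
  have n: "cis (t * n) = S"
    using eq [of "Inl (real n)"] sym_vec_n_pos by (auto simp: modes_def weight_def phase_def)
  have "S = 1"
    using sym_vec_0_pos
  proof
    assume "0 < sym_vec 0 u"
    then show "S = 1" using eq [of "Inl 0"] by (auto simp: modes_def weight_def phase_def)
  next
    assume "sym_vec 0 u = 0 \<and> k = 2"
    then have "cis (t * n) * cis (t * n) = S" using kn by (simp add: cis_mult algebra_simps)
    then show "S = 1" using n by (metis cis_neq_zero mult_cancel_left2)
  qed
  moreover have "Inr x \<in> modes x x'" "Inr x' \<in> modes x x'" by (auto simp: modes_def)
  then have "- cis (t * x) = S" "- cis (t * x') = S"
    using eq [of "Inr x"] eq [of "Inr x'"] weight_skew_pos [OF x] by (simp_all add: phase_def)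
  ultimately show "cis (t * n) = 1 \<and> cis (t * x) = -1 \<and> cis (t * x') = -1"
    using n by (simp add: minus_equation_iff)
next
  assume h: "cis (t * n) = 1 \<and> cis (t * x) = -1 \<and> cis (t * x') = -1"
  have "cis (t * (real k * n)) = cis (t * n) ^ k"
    by (simp add: DeMoivre mult_ac)
  then have "phase t l = 1" if "l \<in> modes x x'" for l
    using that h by (auto simp: modes_def phase_def)
  then have "(\<Sum>l\<in>modes x x'. weight x x' l * phase t l) = complex_of_real (sum (weight x x') (modes x x'))"
    by (simp add: of_real_sum)
  then show "cmod (transition_mat (M \<beta>) t $$ (u, v)) = 1"
    unfolding transition_mat_modes [OF x] weight_sum [OF x] by (simp add: norm_mult)
qed

section \<open>Transfer as a Diophantine equation\<close>

text \<open>The roots \<open>x\<close> and \<open>x'\<close> are real and distinct for every real \<open>\<beta>\<close>.\<close>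

lemma skew_discriminant_pos: "0 < (real n - 2 * \<beta>)\<^sup>2 + 8 * \<beta> * (real n - j)"
proof -
  have "(real n - 2 * \<beta>)\<^sup>2 + 8 * \<beta> * (real n - j)
      = (2 * \<beta> + n - 2 * j)\<^sup>2 + 4 * j * (real n - j)"
    by (simp add: power2_eq_square algebra_simps)
  moreover have "0 < 4 * real j * (real n - j)" using j_pos j_less by simp
  ultimately show ?thesis by (simp add: add_nonneg_pos)
qed

text \<open>Transfer at time \<open>t = 2 \<pi> m / n\<close> means \<open>x = c n / (2 m)\<close> and \<open>x' = c' n / (2 m)\<close> with odd \<open>c\<close>, \<open>c'\<close>.
  Then \<open>\<beta> = (n - x - x') / 2\<close> is automatically rational, and what remains is the condition
  \<open>x x' = (x + x' - n) (n - j)\<close>.\<close>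

lemma exists_pst_iff_transfer_equation:
  "(\<exists>\<beta> \<gamma>. \<beta> \<in> \<rat> \<and> \<gamma> = - \<beta> \<and> perfect_state_transfer (perturbed_mat (oa_graph_mat R) u v \<beta> \<gamma>) u v)
   \<longleftrightarrow> (\<exists>m c c' :: int. 0 < m \<and> odd c \<and> odd c' \<and>
        int n * c * c' = 2 * m * (int n - int j) * (c + c' - 2 * m))"
    (is "?L \<longleftrightarrow> ?R")
proof
  assume ?L
  then obtain \<beta> t where t: "0 < t" "cmod (transition_mat (M \<beta>) t $$ (u, v)) = 1"
    unfolding perfect_state_transfer_def by blast
  define D where "D = (real n - 2 * \<beta>)\<^sup>2 + 8 * \<beta> * (real n - j)"
  have D: "0 < D" unfolding D_def by (rule skew_discriminant_pos)
  define x x' where "x = (real n - 2 * \<beta> + sqrt D) / 2" and "x' = (real n - 2 * \<beta> - sqrt D) / 2"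
  have "x * x' = ((real n - 2 * \<beta>)\<^sup>2 - D) / 4"
    using D by (simp add: x_def x'_def algebra_simps power2_eq_square)
  then have x: "x + x' = real n - 2 * \<beta>" "x * x' = - 2 * \<beta> * (real n - j)" "x \<noteq> x'"
  proof -
    show "x + x' = real n - 2 * \<beta>" by (simp add: x_def x'_def add_divide_distrib [symmetric])
    show "x * x' = - 2 * \<beta> * (real n - j)" unfolding \<open>x * x' = _\<close> D_def by simp
    show "x \<noteq> x'" using D by (simp add: x_def x'_def)
  qed
  from t(2) have ph: "cis (t * n) = 1" "cis (t * x) = -1" "cis (t * x') = -1"
    unfolding transfer_time_iff [OF x] by blast+
  then have "cos (t * n) = 1" by (simp add: complex_eq_iff)
  then obtain m :: int where m: "t * n = m * 2 * pi" by (auto simp: cos_one_2pi_int)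
  then have "0 < m * 2 * pi" using t(1) n_pos by (metis mult_pos_pos)
  then have "0 < m" by (simp add: zero_less_mult_iff)
  obtain c c' :: int where c: "odd c" "odd c'" and tx: "t * x = c * pi" "t * x' = c' * pi"
    using ph by (auto simp: cis_eq_minus_1_iff)
  have scale: "2 * m * y = d * n" if "t * y = d * pi" for y :: real and d :: int
  proof -
    have "t * pi * (2 * m * y) = (m * 2 * pi) * (t * y)" by (simp add: algebra_simps)
    also have "\<dots> = t * pi * (d * n)" unfolding m [symmetric] that by (simp add: algebra_simps)
    finally show ?thesis using t(1) by simp
  qed
  have prod: "x * x' = (x + x' - n) * (real n - j)" using x by simp
  have "(2 * m * x) * (2 * m * x') = 4 * (real_of_int m)\<^sup>2 * (x * x')"
    by (simp add: power2_eq_square)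
  also have "\<dots> = 2 * m * (2 * m * x + 2 * m * x' - 2 * m * n) * (real n - j)"
    unfolding prod by (simp add: power2_eq_square algebra_simps)
  finally have "(2 * m * x) * (2 * m * x')
      = 2 * m * (2 * m * x + 2 * m * x' - 2 * m * n) * (real n - j)" .
  then have "(c * n) * (c' * n) = 2 * m * (c * n + c' * n - 2 * m * n) * (real n - j)"
    unfolding scale [OF tx(1)] scale [OF tx(2)] by simp
  then have "real n * (real n * c * c') = real n * (2 * m * (real n - j) * (c + c' - 2 * m))"
    by (simp add: algebra_simps)
  then have "real n * c * c' = 2 * m * (real n - j) * (c + c' - 2 * m)"
    using n_pos by (metis mult_left_cancel less_irrefl)
  then have "real_of_int (int n * c * c') = real_of_int (2 * m * (int n - int j) * (c + c' - 2 * m))"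
    by simp
  then have "int n * c * c' = 2 * m * (int n - int j) * (c + c' - 2 * m)"
    by (simp only: of_int_eq_iff)
  with \<open>0 < m\<close> c show ?R by blast
next
  assume ?R
  then obtain m c c' :: int where m: "0 < m" and odd: "odd c" "odd c'"
    and eq: "int n * c * c' = 2 * m * (int n - int j) * (c + c' - 2 * m)" by blast
  define x x' where "x = c * real n / (2 * m)" and "x' = c' * real n / (2 * m)"
  define \<beta> where "\<beta> = (real n - x - x') / 2"
  have "real_of_int (int n * c * c') = real_of_int (2 * m * (int n - int j) * (c + c' - 2 * m))"
    by (simp only: eq)
  then have eq': "real n * c * c' = 2 * m * (real n - j) * (c + c' - 2 * m)" by simp
  have "x * x' = real n * (real n * c * c') / (2 * m)\<^sup>2"
    by (simp add: x_def x'_def power2_eq_square)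
  also have "\<dots> = (x + x' - n) * (real n - j)"
    unfolding eq' using m by (simp add: x_def x'_def power2_eq_square field_simps)
  finally have prod: "x * x' = - 2 * \<beta> * (real n - j)" by (simp add: \<beta>_def)
  have sum: "x + x' = real n - 2 * \<beta>" by (simp add: \<beta>_def field_simps)
  have "(x - x')\<^sup>2 = (real n - 2 * \<beta>)\<^sup>2 + 8 * \<beta> * (real n - j)"
    unfolding sum [symmetric] using prod by (simp add: power2_eq_square algebra_simps)
  then have "x \<noteq> x'" using skew_discriminant_pos [of \<beta>] by auto
  define t where "t = 2 * pi * m / n"
  have "t * n = 2 * pi * m" "t * x = c * pi" "t * x' = c' * pi"
    using m n_pos by (simp_all add: t_def x_def x'_def)
  then have "cis (t * n) = 1" "cis (t * x) = -1" "cis (t * x') = -1"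
    using odd unfolding cis_eq_minus_1_iff by auto
  then have "cmod (transition_mat (M \<beta>) t $$ (u, v)) = 1"
    unfolding transfer_time_iff [OF sum prod \<open>x \<noteq> x'\<close>] by blast
  moreover have "0 < t" using m n_pos by (simp add: t_def)
  moreover have "\<beta> \<in> \<rat>" by (simp add: \<beta>_def x_def x'_def)
  ultimately show ?L unfolding perfect_state_transfer_def by blast
qed

end

section \<open>Solvability of the Diophantine equation\<close>

lemma odd_split_2:
  fixes a :: int
  assumes "a \<noteq> 0"
  obtains b where "odd b" "a = 2 ^ multiplicity 2 a * b"
  using multiplicity_decompose' [of a 2] assms by auto

text \<open>Necessity: since \<open>c c'\<close> is odd and \<open>c + c'\<close> even, \<open>n\<close> is divisible by 4 times the power of 2 in
  \<open>n - j\<close>; therefore \<open>j = n - (n - j)\<close> has the same power of 2 as \<open>n - j\<close>. Sufficiency: removing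
  that common power leaves \<open>p c c' = q m ((c + c') / 2 - m)\<close> with \<open>q\<close> odd. For \<open>c = q\<close> this is
  linear in \<open>c'\<close> with leading coefficient proportional to \<open>2 p - m\<close>, so the choice \<open>m = 2 p - 1\<close>
  makes it solvable in integers.\<close>

lemma transfer_equation_solvable_iff:
  fixes n j :: int
  assumes "0 < j" "j < n"
  shows "(\<exists>m c c'. 0 < m \<and> odd c \<and> odd c' \<and> n * c * c' = 2 * m * (n - j) * (c + c' - 2 * m))
    \<longleftrightarrow> multiplicity 2 j + 2 \<le> multiplicity 2 n"
    (is "?L \<longleftrightarrow> ?R")
proof
  assume ?L
  then obtain m c c' where m: "0 < m" and odd: "odd c" "odd c'"
    and eq: "n * c * c' = 2 * m * (n - j) * (c + c' - 2 * m)" by blast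
  define e where "e = multiplicity 2 (n - j)"
  have "2 ^ e dvd n - j" by (simp add: e_def multiplicity_dvd)
  moreover have "2 dvd c + c' - 2 * m" using odd by simp
  ultimately have "2 * 1 * 2 ^ e * 2 dvd 2 * m * (n - j) * (c + c' - 2 * m)"
    by (intro mult_dvd_mono) auto
  then have "2 ^ (e + 2) dvd n * (c * c')" unfolding eq [symmetric] by (simp add: mult_ac)
  moreover have "coprime (2 ^ (e + 2)) (c * c')"
    using odd unfolding coprime_power_left_iff by simp
  ultimately have n: "2 ^ (e + 2) dvd n" by (simp add: coprime_dvd_mult_left_iff)
  then have le: "e + 2 \<le> multiplicity 2 n"
    using assms by (intro multiplicity_geI) auto
  have "\<not> 2 ^ (e + 1) dvd n - j"
    using assms multiplicity_geI [of "n - j" 2 "e + 1"] by (auto simp: e_def)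
  moreover have "2 ^ (e + 1) dvd n" using n by (rule power_le_dvd) simp
  ultimately have "\<not> 2 ^ (e + 1) dvd j" by (metis dvd_diff)
  then have "multiplicity 2 j < e + 1"
    by (metis multiplicity_dvd' not_less)
  then show ?R using le by simp
next
  assume ?R
  define e where "e = multiplicity 2 j"
  obtain i where i: "odd i" "j = 2 ^ e * i"
    using odd_split_2 [of j] assms unfolding e_def by auto
  have "2 ^ (e + 2) dvd n" using \<open>?R\<close> unfolding e_def by (rule multiplicity_dvd')
  then obtain p where "n = 2 ^ (e + 2) * p" by (elim dvdE)
  then have p: "n = 2 ^ e * (4 * p)" by simp
  define q where "q = 4 * p - i"
  have q: "odd q" using i by (simp add: q_def)
  have nj: "n - j = 2 ^ e * q" unfolding p i(2) q_def by (simp add: algebra_simps)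
  have "0 < n" using assms by simp
  then have "0 < p" unfolding p by (simp add: zero_less_mult_iff)
  define m where "m = 2 * p - 1"
  \<comment> \<open>The solution for \<open>c = q\<close> and this \<open>m\<close>; it is odd because \<open>q\<close> is.\<close>
  define c' where "c' = 2 * (p * q - m\<^sup>2) - q"
  have "n * q * c' = 2 * m * (n - j) * (q + c' - 2 * m)"
    unfolding nj unfolding p c'_def m_def by (simp add: power2_eq_square algebra_simps)
  moreover have "odd c'" using q by (simp add: c'_def)
  moreover have "0 < m" using \<open>0 < p\<close> by (simp add: m_def)
  ultimately show ?L using q by blast
qed

section \<open>The characterisation\<close>

lemma exists_pst_iff_multiplicity:
  assumes "2 \<le> k" "k \<le> n" "orthogonal_array k n R" "u < n\<^sup>2" "v < n\<^sup>2" "u \<noteq> v"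
    and "k - agreements R u v < n"
  shows "(\<exists>\<beta> \<gamma>. \<beta> \<in> \<rat> \<and> \<gamma> = - \<beta> \<and>
      perfect_state_transfer (perturbed_mat (oa_graph_mat R) u v \<beta> \<gamma>) u v)
    \<longleftrightarrow> multiplicity 2 (int (k - agreements R u v)) + 2 \<le> multiplicity 2 (int n)"
proof -
  interpret oa_pair k n R u v "k - agreements R u v"
    using assms by unfold_locales auto
  show ?thesis
    unfolding exists_pst_iff_transfer_equation
    by (rule transfer_equation_solvable_iff) (use j_pos j_less in simp_all)
qed

theorem theorem18:
  fixes k n u v :: nat and R :: "nat mat"
  assumes "2 \<le> k" and "k \<le> n"
    and "orthogonal_array k n R"
    and "u < n\<^sup>2" and "v < n\<^sup>2" and "u \<noteq> v"
  shows "(k < n \<and> \<not> oa_adjacent R u v \<longrightarrow>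
      ((\<exists>\<beta> \<gamma> :: real. \<beta> \<in> \<rat> \<and> \<gamma> = - \<beta> \<and>
          perfect_state_transfer (perturbed_mat (oa_graph_mat R) u v \<beta> \<gamma>) u v)
       \<longleftrightarrow> multiplicity 2 (int n) \<ge> multiplicity 2 (int k) + 2)) \<and>
    (oa_adjacent R u v \<longrightarrow>
      ((\<exists>\<beta> \<gamma> :: real. \<beta> \<in> \<rat> \<and> \<gamma> = - \<beta> \<and>
          perfect_state_transfer (perturbed_mat (oa_graph_mat R) u v \<beta> \<gamma>) u v)
       \<longleftrightarrow> multiplicity 2 (int n) \<ge> multiplicity 2 (int k - 1) + 2))"
proof (intro conjI impI)
  interpret oa k n R using assms by unfold_locales
  {
    assume h: "k < n \<and> \<not> oa_adjacent R u v"
    then have "agreements R u v = 0"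
      using agreements_le_1 [OF assms(4-6)] \<open>u \<noteq> v\<close>
      by (simp add: oa_adjacent_iff le_Suc_eq)
    then show "(\<exists>\<beta> \<gamma> :: real. \<beta> \<in> \<rat> \<and> \<gamma> = - \<beta> \<and>
          perfect_state_transfer (perturbed_mat (oa_graph_mat R) u v \<beta> \<gamma>) u v)
       \<longleftrightarrow> multiplicity 2 (int n) \<ge> multiplicity 2 (int k) + 2"
      using exists_pst_iff_multiplicity [OF assms] h by simp
  next
    assume "oa_adjacent R u v"
    then have "agreements R u v = 1"
      by (simp add: oa_adjacent_iff)
    moreover have "int (k - 1) = int k - 1" using \<open>2 \<le> k\<close> by simp
    ultimately show "(\<exists>\<beta> \<gamma> :: real. \<beta> \<in> \<rat> \<and> \<gamma> = - \<beta> \<and>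
          perfect_state_transfer (perturbed_mat (oa_graph_mat R) u v \<beta> \<gamma>) u v)
       \<longleftrightarrow> multiplicity 2 (int n) \<ge> multiplicity 2 (int k - 1) + 2"
      using exists_pst_iff_multiplicity [OF assms] \<open>2 \<le> k\<close> \<open>k \<le> n\<close> by simp
  }
qed

end
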